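(* Let $A\in\mathbb{R}^{m\times n}$ with $2\le m<n$ be a matrix whose columns have unit $\ell_2$-norm. Denote $$q^*=\min_{1\le q\le n}\left\{q:\ \mu_1(q-1)\cdot\mu_1^{(2)}(q-1)\ge1\right\},\qquad \widehat{q}=\min_{1\le q\le n}\left\{q:\ \mu_1(q-1)\ge1\right\}.$$ Then $q^*\ge\widehat{q}$. In particular, if $\mu_1^{(2)}(\widehat{q}-1)<\frac{1}{\mu_1(\widehat{q}-1)}$, then $q^*>\widehat{q}$.
   Context: Let $G=A^TA$ be the Gram matrix of $A$ and let $\widehat{G}=(\widehat{G}_{kj})$ be the $n\times n$ matrix obtained by sorting each row of $(|G_{kj}|)$ in descending order, with the diagonal entry $1$ placed first. For $0\le q\le n-1$, the Babel function is $\mu_1(q)=\max_{1\le k\le n}\sum_{j=2}^{q+1}\widehat{G}_{kj}$ (so $\mu_1(0)=0$); let $k_0=k_0(q)$ be an index attaining this maximum. The sub-Babel function is $\mu_1^{(2)}(q)=\max_{1\le k\le n,\ k\ne k_0}\sum_{j=2}^{q+1}\widehat{G}_{kj}$ (independent of the choice of $k_0$). *)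

theory Defs
  imports "HOL-Analysis.Analysis" "HOL-Library.Multiset"
begin

definition gram :: "real^'n^'m \<Rightarrow> real^'n^'n" where
  "gram A = transpose A ** A"

(* The diagonal entry is put first; the index type 'n carries no order, so the off-diagonal
   entries are collected in a multiset before being sorted. *)
definition sorted_row :: "real^'n^'n \<Rightarrow> 'n \<Rightarrow> real list" where
  "sorted_row G k = \<bar>G $ k $ k\<bar> #
     rev (sorted_list_of_multiset {# \<bar>G $ k $ j\<bar>. j \<in># mset_set (UNIV - {k}) #})"

(* The columns of the sorted matrix are positions 1, ..., n, hence natural numbers;
   list positions start at 0. *)
definition sorted_gram :: "real^'n^'m \<Rightarrow> 'n \<Rightarrow> nat \<Rightarrow> real" where
  "sorted_gram A k j = sorted_row (gram A) k ! (j - 1)"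

lemma length_sorted_row: "length (sorted_row (G :: real^'n^'n) k) = CARD('n)"
proof -
  have "length (sorted_row G k) = Suc (card (UNIV - {k}))"
    by (simp add: sorted_row_def flip: size_mset)
  also have "\<dots> = CARD('n)"
    by (rule card.remove[symmetric]) auto
  finally show ?thesis .
qed

definition row_sum :: "real^'n^'m \<Rightarrow> nat \<Rightarrow> 'n \<Rightarrow> real" where
  "row_sum A q k = (\<Sum>j = 2..q + 1. sorted_gram A k j)"

(* babel, babel_index and sub_babel are meaningful for 0 \<le> q \<le> CARD('n) - 1. *)
definition babel :: "real^'n^'m \<Rightarrow> nat \<Rightarrow> real" where
  "babel A q = (MAX k. row_sum A q k)"

definition babel_index :: "real^'n^'m \<Rightarrow> nat \<Rightarrow> 'n" where
  "babel_index A q = (SOME k. row_sum A q k = babel A q)"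

definition sub_babel :: "real^'n^'m \<Rightarrow> nat \<Rightarrow> real" where
  "sub_babel A q = (MAX k \<in> UNIV - {babel_index A q}. row_sum A q k)"

lemma babel_index_attains: "row_sum A q (babel_index A q) = babel A q"
proof -
  have "babel A q \<in> range (row_sum A q)"
    unfolding babel_def by (rule Max_in) auto
  then have "\<exists>k. row_sum A q k = babel A q"
    by (metis imageE)
  then show ?thesis
    unfolding babel_index_def by (rule someI_ex)
qed

lemma sub_babel_independent_of_choice:
  assumes "row_sum A q k0 = babel A q"
  shows "sub_babel A q = (MAX k \<in> UNIV - {k0}. row_sum A q k)"
proof -
  have "row_sum A q k0 = row_sum A q (babel_index A q)"
    using assms babel_index_attains by metis
  then have "row_sum A q ` (UNIV - {babel_index A q}) = row_sum A q ` (UNIV - {k0})"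
    by (auto simp: image_iff) (metis DiffI UNIV_I singletonD)+
  then show ?thesis
    by (simp add: sub_babel_def)
qed

(* Min of the empty set is an unspecified number, so results about q_star and q_hat rest on the
   sets below being nonempty. *)
definition q_star :: "real^'n^'m \<Rightarrow> nat" where
  "q_star (A :: real^'n^'m) =
     Min {q \<in> {1..CARD('n)}. babel A (q - 1) * sub_babel A (q - 1) \<ge> 1}"

definition q_hat :: "real^'n^'m \<Rightarrow> nat" where
  "q_hat (A :: real^'n^'m) = Min {q \<in> {1..CARD('n)}. babel A (q - 1) \<ge> 1}"

end

theory Submission
  imports Defs
begin

text \<open>Since the sub-Babel function lies between \<open>0\<close> and the Babel function, a product
  \<open>\<mu>\<^sub>1(q - 1) \<mu>\<^sub>1\<^sup>(\<^sup>2\<^sup>)(q - 1) \<ge> 1\<close> forces \<open>\<mu>\<^sub>1(q - 1) \<ge> 1\<close>: every \<open>q\<close> that competes for \<open>q\<^sup>*\<close>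
  competes for the minimum defining the other threshold as well. If moreover the product is below
  \<open>1\<close> at that other threshold, the two minima cannot coincide.

  The substance is that the minimum defining \<open>q\<^sup>*\<close> is taken over a nonempty set, which is where
  \<open>m < n\<close> enters. The Gram matrix is then singular, and Brauer's theorem on ovals of Cassini
  (\<open>brauer_singular\<close>), a sharpening of Gershgorin's theorem, says that for some two distinct rows of a
  singular matrix the product of the off-diagonal absolute sums is at least the product of the
  absolute diagonal entries, here \<open>1\<close>. For \<open>q = n\<close> the truncated row sums are the full off-diagonal sums,
  and the product of any two of them in distinct rows is at most that of the two largest, so
  \<open>q = n\<close> is always admissible.\<close>

lemma UNIV_minus_singleton_nonempty:
  fixes p :: "'n::finite"
  assumes "2 \<le> CARD('n)"
  shows "UNIV - {p} \<noteq> {}"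
proof
  assume "UNIV - {p} = {}"
  then have "(UNIV :: 'n set) = {p}"
    by blast
  then have "CARD('n) = card {p}"
    by (rule arg_cong)
  with assms show False
    by simp
qed

text \<open>The rows are those where a kernel vector has its two absolutely largest entries. In each
  of the two equations the off-diagonal part is bounded by the row sum times the largest entry at
  another position; multiplying the two bounds cancels both entries. If the second
  largest entry is \<open>0\<close>, the equation for the largest one makes a diagonal entry vanish.\<close>
lemma brauer_singular:
  fixes M :: "real^'n^'n"
  assumes "2 \<le> CARD('n)" and ker: "M *v x = 0" and "x \<noteq> 0"
  obtains i j where "i \<noteq> j"
    and "\<bar>M $ i $ i\<bar> * \<bar>M $ j $ j\<bar> \<le>
      (\<Sum>l\<in>UNIV - {i}. \<bar>M $ i $ l\<bar>) * (\<Sum>l\<in>UNIV - {j}. \<bar>M $ j $ l\<bar>)"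
proof -
  define r where "r i = (\<Sum>l\<in>UNIV - {i}. \<bar>M $ i $ l\<bar>)" for i
  have r_nonneg: "r i \<ge> 0" for i
    by (auto simp: r_def intro: sum_nonneg)
  have row: "\<bar>M $ i $ i\<bar> * \<bar>x $ i\<bar> \<le> r i * b" if b: "\<And>l. l \<noteq> i \<Longrightarrow> \<bar>x $ l\<bar> \<le> b" for i b
  proof -
    have "0 = (\<Sum>l\<in>UNIV. M $ i $ l * x $ l)"
      using ker by (simp add: vec_eq_iff matrix_vector_mult_def)
    also have "\<dots> = M $ i $ i * x $ i + (\<Sum>l\<in>UNIV - {i}. M $ i $ l * x $ l)"
      by (simp add: sum.remove)
    finally have "\<bar>M $ i $ i\<bar> * \<bar>x $ i\<bar> = \<bar>\<Sum>l\<in>UNIV - {i}. M $ i $ l * x $ l\<bar>"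
      by (simp flip: abs_mult)
    also have "\<dots> \<le> (\<Sum>l\<in>UNIV - {i}. \<bar>M $ i $ l\<bar> * \<bar>x $ l\<bar>)"
      by (rule order_trans[OF sum_abs]) (simp add: abs_mult)
    also have "\<dots> \<le> (\<Sum>l\<in>UNIV - {i}. \<bar>M $ i $ l\<bar> * b)"
      by (rule sum_mono) (auto intro: mult_left_mono b)
    finally show ?thesis
      by (simp add: r_def sum_distrib_right)
  qed
  obtain p where p: "\<And>l. \<bar>x $ l\<bar> \<le> \<bar>x $ p\<bar>"
    using ex_is_arg_min_if_finite[of "UNIV :: 'n set" "\<lambda>l. - \<bar>x $ l\<bar>"]
    by (auto simp: is_arg_min_linorder)
  obtain s where s: "s \<noteq> p" "\<And>l. l \<noteq> p \<Longrightarrow> \<bar>x $ l\<bar> \<le> \<bar>x $ s\<bar>"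
    using ex_is_arg_min_if_finite[of "UNIV - {p}" "\<lambda>l. - \<bar>x $ l\<bar>"]
      UNIV_minus_singleton_nonempty[OF assms(1), of p]
    by (auto simp: is_arg_min_linorder)
  have "x $ p \<noteq> 0"
    using \<open>x \<noteq> 0\<close> p by (auto simp: vec_eq_iff)
  have P: "\<bar>M $ p $ p\<bar> * \<bar>x $ p\<bar> \<le> r p * \<bar>x $ s\<bar>"
    by (rule row) (rule s)
  have S: "\<bar>M $ s $ s\<bar> * \<bar>x $ s\<bar> \<le> r s * \<bar>x $ p\<bar>"
    by (rule row) (rule p)
  have "\<bar>M $ p $ p\<bar> * \<bar>M $ s $ s\<bar> \<le> r p * r s"
  proof (cases "x $ s = 0")
    case True
    with P \<open>x $ p \<noteq> 0\<close> have "M $ p $ p = 0"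
      by (simp add: mult_le_0_iff)
    then show ?thesis
      by (simp add: r_nonneg)
  next
    case False
    have "(\<bar>M $ p $ p\<bar> * \<bar>M $ s $ s\<bar>) * (\<bar>x $ p\<bar> * \<bar>x $ s\<bar>) \<le> (r p * r s) * (\<bar>x $ p\<bar> * \<bar>x $ s\<bar>)"
      using mult_mono[OF P S] r_nonneg[of p] by (simp add: mult_ac)
    with False \<open>x $ p \<noteq> 0\<close> show ?thesis
      by (simp add: mult_le_cancel_right mult_le_0_iff)
  qed
  with s(1) that[of p s] show thesis
    by (auto simp: r_def)
qed

lemma wide_matrix_kernel:
  fixes A :: "real^'n^'m"
  assumes "CARD('m) < CARD('n)"
  obtains x where "x \<noteq> 0" "A *v x = 0"
proof -
  have "rank A < CARD('n)"
    using rank_bound[of A] assms by linarith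
  then have "\<not> inj ((*v) A)"
    by (simp add: less_rank_noninjective)
  then show thesis
    using that by (auto simp: linear_injective_0[OF matrix_vector_mul_linear])
qed

lemma gram_diagonal: "gram A $ k $ k = (norm (column k A))\<^sup>2"
  by (simp add: gram_def matrix_matrix_mult_def transpose_def column_def power2_norm_eq_inner
      inner_vec_def)

lemma sorted_gram_nonneg:
  fixes A :: "real^'n^'m"
  assumes "j - 1 < CARD('n)"
  shows "sorted_gram A k j \<ge> 0"
proof -
  have "sorted_gram A k j \<in> set (sorted_row (gram A) k)"
    unfolding sorted_gram_def by (rule nth_mem) (use assms in \<open>simp add: length_sorted_row\<close>)
  then show ?thesis
    by (auto simp: sorted_row_def)
qed

lemma row_sum_nonneg:
  fixes A :: "real^'n^'m"
  assumes "q < CARD('n)"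
  shows "row_sum A q k \<ge> 0"
  unfolding row_sum_def by (rule sum_nonneg, rule sorted_gram_nonneg) (use assms in auto)

text \<open>Sorting does not affect the sum of a row that is added up completely.\<close>
lemma row_sum_full:
  fixes A :: "real^'n^'m"
  shows "row_sum A (CARD('n) - 1) k = (\<Sum>l\<in>UNIV - {k}. \<bar>gram A $ k $ l\<bar>)"
proof -
  define xs where
    "xs = rev (sorted_list_of_multiset {# \<bar>gram A $ k $ l\<bar>. l \<in># mset_set (UNIV - {k}) #})"
  have row: "sorted_row (gram A) k = \<bar>gram A $ k $ k\<bar> # xs"
    by (simp add: sorted_row_def xs_def)
  then have len: "CARD('n) = Suc (length xs)"
    using length_sorted_row[of "gram A" k] by simp
  have "row_sum A (CARD('n) - 1) k = (\<Sum>j = 0 + 2..<length xs + 2. sorted_gram A k j)"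
    unfolding row_sum_def by (rule sum.cong) (auto simp: len)
  also have "\<dots> = (\<Sum>i = 0..<length xs. xs ! i)"
    by (subst sum.shift_bounds_nat_ivl) (simp add: sorted_gram_def row)
  also have "\<dots> = sum_mset (mset xs)"
    by (simp only: sum_list_sum_nth sum_mset_sum_list)
  also have "\<dots> = (\<Sum>l\<in>UNIV - {k}. \<bar>gram A $ k $ l\<bar>)"
    by (simp add: xs_def sum_unfold_sum_mset)
  finally show ?thesis .
qed

lemma row_sum_le_babel: "row_sum A q k \<le> babel A q"
  unfolding babel_def by (rule Max_ge) auto

lemma row_sum_le_sub_babel:
  "k \<noteq> babel_index A q \<Longrightarrow> row_sum A q k \<le> sub_babel A q"
  unfolding sub_babel_def by (rule Max_ge) auto

text \<open>The second largest value exists only if there are two rows.\<close>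
lemma sub_babel_attained:
  fixes A :: "real^'n^'m"
  assumes "2 \<le> CARD('n)"
  obtains k where "sub_babel A q = row_sum A q k"
proof -
  have "sub_babel A q \<in> row_sum A q ` (UNIV - {babel_index A q})"
    unfolding sub_babel_def using UNIV_minus_singleton_nonempty[OF assms]
    by (intro Max_in) simp_all
  then show thesis
    using that by auto
qed

text \<open>At least one of two distinct rows differs from the maximizing row, so it is bounded by the
  second maximum.\<close>
lemma row_sum_mult_le_babel_mult_sub_babel:
  fixes A :: "real^'n^'m"
  assumes "q < CARD('n)" and "i \<noteq> j"
  shows "row_sum A q i * row_sum A q j \<le> babel A q * sub_babel A q"
proof -
  have bound: "row_sum A q i * row_sum A q j \<le> babel A q * sub_babel A q"
    if "j \<noteq> babel_index A q" for i j
    using row_sum_nonneg[OF assms(1), of A i] row_sum_nonneg[OF assms(1), of A j]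
      row_sum_le_babel[of A q i] row_sum_le_sub_babel[OF that]
    by (intro mult_mono) auto
  show ?thesis
  proof (cases "j = babel_index A q")
    case True
    then have "row_sum A q j * row_sum A q i \<le> babel A q * sub_babel A q"
      using assms(2) by (intro bound) simp
    then show ?thesis
      by (simp add: mult.commute[of "row_sum A q j"])
  qed (rule bound)
qed

lemma babel_ge_1:
  fixes A :: "real^'n^'m"
  assumes "2 \<le> CARD('n)" and q: "q < CARD('n)" and "babel A q * sub_babel A q \<ge> 1"
  shows "babel A q \<ge> 1"
proof (rule ccontr)
  obtain k where k: "sub_babel A q = row_sum A q k"
    using sub_babel_attained[OF assms(1)] .
  assume "\<not> babel A q \<ge> 1"
  moreover have "0 \<le> sub_babel A q" "sub_babel A q \<le> babel A q"
    using row_sum_nonneg[OF q, of A k] row_sum_le_babel[of A q k] k by auto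
  ultimately have "babel A q * sub_babel A q \<le> babel A q"
    by (intro mult_right_le_one_le) auto
  with assms(3) \<open>\<not> babel A q \<ge> 1\<close> show False
    by linarith
qed

lemma one_le_full_babel_mult_sub_babel:
  fixes A :: "real^'n^'m"
  assumes "2 \<le> CARD('n)" and "CARD('m) < CARD('n)" and unit: "\<And>k. norm (column k A) = 1"
  shows "1 \<le> babel A (CARD('n) - 1) * sub_babel A (CARD('n) - 1)"
proof -
  obtain x where x: "x \<noteq> 0" "A *v x = 0"
    using wide_matrix_kernel[OF assms(2)] .
  have "gram A *v x = 0"
    by (simp add: gram_def x(2) flip: matrix_vector_mul_assoc)
  then obtain i j where "i \<noteq> j" and ij: "\<bar>gram A $ i $ i\<bar> * \<bar>gram A $ j $ j\<bar> \<le>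
      (\<Sum>l\<in>UNIV - {i}. \<bar>gram A $ i $ l\<bar>) * (\<Sum>l\<in>UNIV - {j}. \<bar>gram A $ j $ l\<bar>)"
    using brauer_singular[OF assms(1) _ x(1)] by blast
  from ij have "1 \<le> row_sum A (CARD('n) - 1) i * row_sum A (CARD('n) - 1) j"
    by (simp only: row_sum_full) (simp add: gram_diagonal unit)
  also have "\<dots> \<le> babel A (CARD('n) - 1) * sub_babel A (CARD('n) - 1)"
    using \<open>i \<noteq> j\<close> by (intro row_sum_mult_le_babel_mult_sub_babel) auto
  finally show ?thesis .
qed

theorem proposition3p2:
  fixes A :: "real^'n^'m"
  assumes "2 \<le> CARD('m)" and "CARD('m) < CARD('n)"
    and "\<And>k. norm (column k A) = 1"
  shows "q_star A \<ge> q_hat A \<and>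
    (sub_babel A (q_hat A - 1) < 1 / babel A (q_hat A - 1) \<longrightarrow> q_star A > q_hat A)"
proof -
  define S where "S = {q \<in> {1..CARD('n)}. babel A (q - 1) * sub_babel A (q - 1) \<ge> 1}"
  define H where "H = {q \<in> {1..CARD('n)}. babel A (q - 1) \<ge> 1}"
  have n: "2 \<le> CARD('n)"
    using assms by simp
  have "S \<subseteq> H"
    using babel_ge_1[OF n, where A = A] by (auto simp: S_def H_def Suc_le_eq)
  have "CARD('n) \<in> S"
    using one_le_full_babel_mult_sub_babel[OF n assms(2,3)] n by (simp add: S_def)
  then have star: "q_star A \<in> S"
    unfolding q_star_def S_def[symmetric] by (intro Min_in) (auto simp: S_def)
  with \<open>S \<subseteq> H\<close> have le: "q_hat A \<le> q_star A"
    unfolding q_hat_def H_def[symmetric] by (intro Min_le) (auto simp: H_def)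
  have "q_hat A \<in> H"
    unfolding q_hat_def H_def[symmetric] using star \<open>S \<subseteq> H\<close>
    by (intro Min_in) (auto simp: H_def)
  then have "babel A (q_hat A - 1) > 0"
    by (simp add: H_def)
  then have "q_hat A \<notin> S" if "sub_babel A (q_hat A - 1) < 1 / babel A (q_hat A - 1)"
    using that by (simp add: S_def field_simps)
  with le star show ?thesis
    by (metis le_neq_implies_less)
qed

end
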